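(* Let $N$ be a positive integer and let $a,b$ be real parameters such that no denominator appearing below or in the context vanishes. The rational functions of $q$-Hahn type $\mathcal V_m(n)=\mathcal V_m(n;a,b,N;q)$ obey the following recurrence relation for $m,n=0,1,\dots,N$: $$[n-N+m+b-a+2]_q\,q^{2N-4m-2b}\mathcal A_m\big(\mathcal V_{m+1}(n)-\mathcal V_m(n)\big)+[n-m-a+2]_q\,\mathcal C_m\big(\mathcal V_{m-1}(n)-\mathcal V_m(n)\big)=-q^2[a-b-2]_q[N-2m-b]_q\,\mathcal V_m(n),$$ where $$\mathcal A_m=q^{a+m}\frac{[-m-b-1]_q[m+b-N]_q}{[N-2m-b-1]_q},\qquad \mathcal C_m=q^a\frac{[m]_q[m-N-1]_q}{[2m+b-N-1]_q}.$$
   Context: $q$ is real, $q>0$, $q\ne1$; $[x]_q=\frac{1-q^x}{1-q}$; $(a;q)_0=1$, $(a;q)_k=\prod_{i=0}^{k-1}(1-aq^i)$. For $m=0,\dots,N$, $$\mathcal U_m(x;a,b,N;q)=q^{m(N-m-b)}\frac{(q^{-N};q)_m}{(q^{-m-b};q)_m}\sum_{k=0}^m\frac{(q^{-m};q)_k(q^{-x};q)_k(q^{b+m-N};q)_k}{(q^{-N};q)_k(q^{a-x};q)_k}\frac{q^k}{(q;q)_k},$$ $$\mathcal V_m(x;a,b,N;q)=\mathcal U_m(N-x;b-a+2,b,N;q^{-1}),$$ where in the second line $q$ is replaced by $q^{-1}$ everywhere in the definition of $\mathcal U_m$. Conventions at the ends: $\mathcal V_{N+1}(n)=0$ for $n=0,\dots,N$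 (because of the factor $(q^{-N};q)_{N+1}=0$), and the term with $\mathcal V_{-1}$ is absent since $\mathcal C_0=0$. The nonvanishing of denominators holds for instance if $a$, $b$ and $a-b$ are not integers. *)

theory Defs
  imports Complex_Main
begin

definition qnum :: "real \<Rightarrow> real \<Rightarrow> real" where
  "qnum q x = (1 - q powr x) / (1 - q)"

definition qpoch :: "real \<Rightarrow> real \<Rightarrow> nat \<Rightarrow> real" where
  "qpoch c q k = (\<Prod>i<k. 1 - c * q ^ i)"

text \<open>
  The index m ranges over 0, ..., N; the value at m = N + 1 given by the formula is used only
  through \<open>qHahn_V_Suc_N\<close> below.
\<close>

definition qHahn_U :: "nat \<Rightarrow> real \<Rightarrow> real \<Rightarrow> real \<Rightarrow> nat \<Rightarrow> real \<Rightarrow> real" where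
  "qHahn_U m x a b N q =
     q powr (real m * (real N - real m - b))
     * (qpoch (q powr (- real N)) q m / qpoch (q powr (- real m - b)) q m)
     * (\<Sum>k\<le>m. (qpoch (q powr (- real m)) q k * qpoch (q powr (- x)) q k
                   * qpoch (q powr (b + real m - real N)) q k)
                / (qpoch (q powr (- real N)) q k * qpoch (q powr (a - x)) q k)
                * (q ^ k / qpoch q q k))"

text \<open>No denominator in the definition of \<open>qHahn_U m x a b N q\<close> vanishes.\<close>

definition qHahn_U_defined :: "nat \<Rightarrow> real \<Rightarrow> real \<Rightarrow> real \<Rightarrow> nat \<Rightarrow> real \<Rightarrow> bool" where
  "qHahn_U_defined m x a b N q \<longleftrightarrow>
     qpoch (q powr (- real m - b)) q m \<noteq> 0 \<and>
     (\<forall>k\<le>m. qpoch (q powr (- real N)) q k \<noteq> 0 \<and> qpoch (q powr (a - x)) q k \<noteq> 0 \<and>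
             qpoch q q k \<noteq> 0)"

definition qHahn_V :: "nat \<Rightarrow> real \<Rightarrow> real \<Rightarrow> real \<Rightarrow> nat \<Rightarrow> real \<Rightarrow> real" where
  "qHahn_V m x a b N q = qHahn_U m (real N - x) (b - a + 2) b N (1 / q)"

definition qHahn_V_defined :: "nat \<Rightarrow> real \<Rightarrow> real \<Rightarrow> real \<Rightarrow> nat \<Rightarrow> real \<Rightarrow> bool" where
  "qHahn_V_defined m x a b N q \<longleftrightarrow> qHahn_U_defined m (real N - x) (b - a + 2) b N (1 / q)"

definition rec_A :: "nat \<Rightarrow> real \<Rightarrow> real \<Rightarrow> nat \<Rightarrow> real \<Rightarrow> real" where
  "rec_A m a b N q =
     q powr (a + real m) * ((qnum q (- real m - b - 1) * qnum q (real m + b - real N))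
                            / qnum q (real N - 2 * real m - b - 1))"

definition rec_C :: "nat \<Rightarrow> real \<Rightarrow> real \<Rightarrow> nat \<Rightarrow> real \<Rightarrow> real" where
  "rec_C m a b N q =
     q powr a * ((qnum q (real m) * qnum q (real m - real N - 1))
                 / qnum q (2 * real m + b - real N - 1))"

text \<open>
  The convention for the index N + 1 is automatic, since division is total and the prefactor
  contains a vanishing q-Pochhammer symbol.
\<close>

lemma qHahn_V_Suc_N:
  assumes "q > 0"
  shows "qHahn_V (Suc N) x a b N q = 0"
proof -
  have "(1 / q) powr (- real N) * (1 / q) ^ N = 1"
    using assms by (simp add: powr_minus powr_realpow)
  then have "qpoch ((1 / q) powr (- real N)) (1 / q) (Suc N) = 0"
    unfolding qpoch_def by simp
  then show ?thesis
    by (simp add: qHahn_V_def qHahn_U_def)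
qed

end

theory Submission
  imports Defs
begin

text \<open>
  With \<open>p = 1 / q\<close>, the three sums in the recurrence may all be taken over \<open>k \<le> N\<close>. Their
  \<open>k\<close>-th summands, combined with the coefficients of the recurrence, form a telescoping
  difference \<open>G (k + 1) - G k\<close>, where \<open>G 0 = 0\<close> and
  \<open>G (k + 1) = (p\<^sup>b\<^sup>-\<^sup>N s\<^sup>2 - 1) (p\<^sup>-\<^sup>k - y) u k\<close> with \<open>s = p\<^sup>m\<close>, \<open>y = p\<^sup>n\<^sup>-\<^sup>N\<close> and \<open>u k\<close> the summand of
  index \<open>m\<close>. The boundary value \<open>G (N + 1)\<close> vanishes because \<open>y\<close> is one of
  \<open>1, p\<^sup>-\<^sup>1, \<dots>, p\<^sup>-\<^sup>N\<close>: the factor \<open>(y; p)\<^sub>N\<close> of \<open>u N\<close> is zero unless \<open>y = p\<^sup>-\<^sup>N\<close>.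
\<close>

section \<open>Elementary rules for q-Pochhammer symbols\<close>

lemma qpoch_0 [simp]: "qpoch c q 0 = 1"
  by (simp add: qpoch_def)

lemma qpoch_Suc: "qpoch c q (Suc k) = qpoch c q k * (1 - c * q ^ k)"
  by (simp add: qpoch_def)

lemma qpoch_Suc_left: "qpoch c q (Suc k) = (1 - c) * qpoch (c * q) q k"
  unfolding qpoch_def by (subst prod.lessThan_Suc_shift) (simp add: mult.assoc)

lemma qpoch_eq_0_mono:
  assumes "qpoch c q k = 0" and "k \<le> l"
  shows "qpoch c q l = 0"
  using assms unfolding qpoch_def by force

section \<open>The telescoping relation between summands\<close>

text \<open>
  The summand of \<open>qHahn_U m x \<alpha> b N p\<close> is the case \<open>s = p\<^sup>m\<close>, \<open>y = p\<^sup>-\<^sup>x\<close>, \<open>w = p\<^sup>\<alpha>\<close>, \<open>v = p\<^sup>-\<^sup>N\<close>,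
  \<open>c = p\<^sup>b\<^sup>-\<^sup>N\<close>; below also \<open>be = p\<^sup>b\<close>. Shifting \<open>m\<close> by one multiplies or divides \<open>s\<close> by \<open>p\<close>.
\<close>

definition qHahn_term ::
    "real \<Rightarrow> real \<Rightarrow> real \<Rightarrow> real \<Rightarrow> real \<Rightarrow> real \<Rightarrow> nat \<Rightarrow> real" where
  "qHahn_term p y w v c s k =
     (qpoch (1 / s) p k * qpoch y p k * qpoch (c * s) p k)
       / (qpoch v p k * qpoch (w * y) p k) * (p ^ k / qpoch p p k)"

text \<open>What remains of the telescoping relation at \<open>k = j + 1\<close>, with \<open>J = p\<^sup>j\<close>, after removal of common factors.\<close>

lemma telescope_Suc_identity:
  fixes p s v be w y J :: real
  assumes "c = be * v" and "p \<noteq> 0" and "s \<noteq> 0" and "J \<noteq> 0"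
    and "1 - c * s\<^sup>2 * p \<noteq> 0" and "1 - c * s\<^sup>2 / p \<noteq> 0"
  shows
    "p * ((y * w * s - 1) / (1 - c * s\<^sup>2 * p)
         * ((1 - v * s) * ((1 - 1 / (s * p)) * (1 - c * s * J) * (1 - c * s * p * J))
            + v * s * (1 - s * be * p) * ((1 - c * s) * (1 - J / s) * (1 - c * s * J)))
       + (y * w - c * s) / (1 - c * s\<^sup>2 / p)
         * (v * s / p * (1 - s * be) * (- s * (1 - J / s) * (1 - J * p / s) * (1 - c * s / p))
            + (1 - s * v / p) * ((1 - s) * (1 - J / s) * (1 - c * s * J)))
       + y * (1 - w) * (1 - c * s\<^sup>2) * ((1 - J / s) * (1 - c * s * J)))
     = (c * s\<^sup>2 - 1) / J
       * ((1 - y * p * J) * (1 - J / s) * (1 - c * s * J)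
          - (1 - v * J) * (1 - p * J) * (1 - w * y * J))" (is "?L = ?R")
proof -
  \<comment> \<open>Because \<open>c = be * v\<close>, each of the two brackets is divisible by the
    denominator in front of it; \<open>X\<close> and \<open>Y\<close> are the nontrivial factors of
    the quotients.\<close>
  define X where "X = s * p + v * s - 1 - c * s\<^sup>2 * p - s * (v - c) * p * J"
  define Y where "Y = p - s * p - s * v + c * s\<^sup>2 + s * (v - c) * p * J"
  have 1: "(1 - v * s) * ((1 - 1 / (s * p)) * (1 - c * s * J) * (1 - c * s * p * J))
            + v * s * (1 - s * be * p) * ((1 - c * s) * (1 - J / s) * (1 - c * s * J))
       = (1 - c * s\<^sup>2 * p) * ((1 - c * s * J) * X / (s * p))"
  proof -
    have "(1 - v * s) * (s * p - 1) * (1 - c * s * p * J)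
            + v * s * (1 - s * be * p) * (1 - c * s) * (s - J) * p = (1 - c * s\<^sup>2 * p) * X"
      unfolding X_def assms(1) by algebra
    then show ?thesis
      using assms(2,3) by (simp add: divide_simps) algebra
  qed
  have 2: "v * s / p * (1 - s * be) * (- s * (1 - J / s) * (1 - J * p / s) * (1 - c * s / p))
            + (1 - s * v / p) * ((1 - s) * (1 - J / s) * (1 - c * s * J))
       = (1 - c * s\<^sup>2 / p) * ((1 - J / s) * Y / p)"
  proof -
    have "- v * s * (1 - s * be) * (s - J * p) * (p - c * s)
            + p * (p - s * v) * (1 - s) * (1 - c * s * J) = (p - c * s\<^sup>2) * Y"
      unfolding Y_def assms(1) by algebra
    then show ?thesis
      using assms(2,3) by (simp add: divide_simps power2_eq_square) algebra
  qed
  have cancel: "a / d * (d * e) = a * e" if "d \<noteq> 0" for a d e :: real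
    using that by simp
  have "?L = p * ((y * w * s - 1) * ((1 - c * s * J) * X / (s * p))
       + (y * w - c * s) * ((1 - J / s) * Y / p)
       + y * (1 - w) * (1 - c * s\<^sup>2) * ((1 - J / s) * (1 - c * s * J)))"
    unfolding 1 2 cancel[OF assms(5)] cancel[OF assms(6)] ..
  also have "\<dots> = ((y * w * s - 1) * (1 - c * s * J) * X
       + (y * w - c * s) * (s - J) * Y
       + p * y * (1 - w) * (1 - c * s\<^sup>2) * (s - J) * (1 - c * s * J)) / s"
    using assms by (simp add: field_simps)
  also have "\<dots> = (c * s\<^sup>2 - 1) * ((1 - y * p * J) * (s - J) * (1 - c * s * J)
          - s * (1 - v * J) * (1 - p * J) * (1 - w * y * J)) / (J * s)"
  proof -
    have "J * ((y * w * s - 1) * (1 - c * s * J) * X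
       + (y * w - c * s) * (s - J) * Y
       + p * y * (1 - w) * (1 - c * s\<^sup>2) * (s - J) * (1 - c * s * J))
      = (c * s\<^sup>2 - 1) * ((1 - y * p * J) * (s - J) * (1 - c * s * J)
          - s * (1 - v * J) * (1 - p * J) * (1 - w * y * J))"
      unfolding X_def Y_def by algebra
    then show ?thesis
      using assms(3,4) by (metis mult_divide_mult_cancel_left)
  qed
  also have "\<dots> = ?R"
    using assms by (simp add: field_simps)
  finally show ?thesis .
qed

text \<open>For \<open>k = j + 1\<close>, the summands at \<open>s * p\<close>, \<open>s\<close> and
  \<open>s / p\<close> differ only in the two symbols that contain \<open>s\<close>. Taking out the
  factors they share with summand \<open>j\<close> reduces the claim to
  \<open>telescope_Suc_identity\<close>. The case \<open>k = 0\<close>, which has no preceding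
  summand, is checked directly.\<close>

lemma qHahn_term_telescope:
  fixes p s v be w y :: real
  defines "c \<equiv> be * v"
  defines "u \<equiv> qHahn_term p y w v c"
  assumes nz: "p \<noteq> 0" "s \<noteq> 0"
    and d: "1 - c * s\<^sup>2 * p \<noteq> 0" "1 - c * s\<^sup>2 / p \<noteq> 0"
    and def: "qpoch v p k \<noteq> 0" "qpoch (w * y) p k \<noteq> 0" "qpoch p p k \<noteq> 0"
  shows
    "(y * w * s - 1) * (1 - c * s) / (1 - c * s\<^sup>2 * p)
         * ((1 - v * s) * u (s * p) k + v * s * (1 - s * be * p) * u s k)
     + (y * w - c * s) * (1 - s) / (1 - c * s\<^sup>2 / p)
         * (v * s / p * (1 - s * be) * u (s / p) k + (1 - s * v / p) * u s k)
     + y * (1 - w) * (1 - c * s\<^sup>2) * u s k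
     = (c * s\<^sup>2 - 1) * ((1 / p ^ k - y) * u s k
         - (if k = 0 then 0 else (1 / p ^ (k - 1) - y) * u s (k - 1)))"
proof (cases k)
  case 0
  \<comment> \<open>All three summands are 1, so by \<open>1\<close> and \<open>2\<close> each
    bracket cancels the denominator in front of it.\<close>
  have u0: "u t 0 = 1" for t
    by (simp add: u_def qHahn_term_def)
  have 1: "(1 - v * s) + v * s * (1 - s * be * p) = 1 - c * s\<^sup>2 * p"
    unfolding c_def by algebra
  have 2: "v * s / p * (1 - s * be) + (1 - s * v / p) = 1 - c * s\<^sup>2 / p"
    unfolding c_def using nz by (simp add: field_simps power2_eq_square)
  have 3: "(y * w * s - 1) * (1 - c * s) + (y * w - c * s) * (1 - s) + y * (1 - w) * (1 - c * s\<^sup>2)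
      = (c * s\<^sup>2 - 1) * (1 - y)"
    by algebra
  show ?thesis
    unfolding 0 u0 mult_1_right 1 2 power_0 using d by (simp add: 3)
next
  case (Suc j)
  define J where "J = p ^ j"
  define E where "E = p / ((1 - v * J) * (1 - p * J) * (1 - w * y * J))"
  have J: "J \<noteq> 0"
    using nz by (simp add: J_def)
  have dd: "1 - v * J \<noteq> 0" "1 - p * J \<noteq> 0" "1 - w * y * J \<noteq> 0"
    using def by (auto simp: Suc qpoch_Suc J_def)
  \<comment> \<open>\<open>R t\<close> collects the factors of summand \<open>k\<close> that change
    with \<open>t\<close>; the rest, \<open>g * (1 - y * J) * E\<close>, is the same for all
    shifts.\<close>
  define R where "R t = qpoch (1 / t) p k * qpoch (c * t) p k" for t
  define f where "f = qpoch (1 / s) p j * qpoch (c * s) p j"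
  define g where "g = qpoch y p j / (qpoch v p j * qpoch (w * y) p j) * (p ^ j / qpoch p p j)"
  have uk: "u t k = R t * (g * (1 - y * J) * E)" for t
    unfolding u_def qHahn_term_def R_def g_def E_def J_def Suc qpoch_Suc
    by (simp add: mult_ac)
  have uj: "u s j = f * g"
    unfolding u_def qHahn_term_def f_def g_def by simp
  have R0: "R s = f * ((1 - J / s) * (1 - c * s * J))"
    by (simp add: R_def f_def Suc qpoch_Suc J_def)
  \<comment> \<open>The factors \<open>1 - c * s\<close> and \<open>1 - s\<close> of the coefficients let both shifts be expressed without
    division, so that \<open>c * s = 1\<close> and \<open>s = 1\<close> (that is, \<open>m = 0\<close>) need no separate treatment.\<close>
  have Rp: "(1 - c * s) * R (s * p) = f * ((1 - 1 / (s * p)) * (1 - c * s * J) * (1 - c * s * p * J))"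
  proof -
    have "(1 - c * s) * qpoch (c * (s * p)) p k = qpoch (c * s) p (Suc (Suc j))"
      unfolding Suc by (subst (2) qpoch_Suc_left) (simp add: mult.assoc)
    moreover have "qpoch (1 / (s * p)) p k = (1 - 1 / (s * p)) * qpoch (1 / s) p j"
      unfolding Suc qpoch_Suc_left using nz by simp
    ultimately show ?thesis
      by (simp add: R_def f_def qpoch_Suc J_def mult_ac)
  qed
  have Rm: "(1 - s) * R (s / p)
      = f * (- s * (1 - J / s) * (1 - J * p / s) * (1 - c * s / p))"
  proof -
    have "(1 - 1 / s) * qpoch (1 / (s / p)) p k = qpoch (1 / s) p (Suc (Suc j))"
      unfolding Suc by (subst (2) qpoch_Suc_left) simp
    moreover have "qpoch (c * (s / p)) p k = (1 - c * s / p) * qpoch (c * s) p j"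
      unfolding Suc qpoch_Suc_left using nz by simp
    moreover have "1 - s = - s * (1 - 1 / s)"
      using nz by (simp add: field_simps)
    ultimately show ?thesis
      by (simp add: R_def f_def qpoch_Suc J_def mult_ac)
  qed
  let ?a = "(y * w * s - 1) / (1 - c * s\<^sup>2 * p)"
  let ?b = "(y * w - c * s) / (1 - c * s\<^sup>2 / p)"
  let ?e = "y * (1 - w) * (1 - c * s\<^sup>2)"
  have "(y * w * s - 1) * (1 - c * s) / (1 - c * s\<^sup>2 * p)
         * ((1 - v * s) * u (s * p) k + v * s * (1 - s * be * p) * u s k)
     + (y * w - c * s) * (1 - s) / (1 - c * s\<^sup>2 / p)
         * (v * s / p * (1 - s * be) * u (s / p) k + (1 - s * v / p) * u s k)
     + y * (1 - w) * (1 - c * s\<^sup>2) * u s k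
    = (g * (1 - y * J) * E) *
      (?a * ((1 - v * s) * ((1 - c * s) * R (s * p)) + v * s * (1 - s * be * p) * ((1 - c * s) * R s))
     + ?b * (v * s / p * (1 - s * be) * ((1 - s) * R (s / p)) + (1 - s * v / p) * ((1 - s) * R s))
     + ?e * R s)"
    unfolding uk times_divide_eq_left[symmetric] by algebra
  also have "\<dots> = f * g * (1 - y * J) * (E / p) * (p *
      (?a * ((1 - v * s) * ((1 - 1 / (s * p)) * (1 - c * s * J) * (1 - c * s * p * J))
            + v * s * (1 - s * be * p) * ((1 - c * s) * (1 - J / s) * (1 - c * s * J)))
       + ?b * (v * s / p * (1 - s * be) * (- s * (1 - J / s) * (1 - J * p / s) * (1 - c * s / p))
            + (1 - s * v / p) * ((1 - s) * (1 - J / s) * (1 - c * s * J)))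
       + ?e * ((1 - J / s) * (1 - c * s * J))))"
  proof -
    have E: "E = E / p * p"
      using nz by simp
    show ?thesis
      unfolding Rp Rm R0 by (subst E) algebra
  qed
  also have "\<dots> = f * g * (1 - y * J) * (E / p) * ((c * s\<^sup>2 - 1) / J
       * ((1 - y * p * J) * (1 - J / s) * (1 - c * s * J)
          - (1 - v * J) * (1 - p * J) * (1 - w * y * J)))"
    by (subst telescope_Suc_identity) (use c_def nz J d in auto)
  also have "\<dots> = (c * s\<^sup>2 - 1) * ((1 - y * p * J) / (p * J) * (R s * (g * (1 - y * J) * E))
         - (1 - y * J) / J * (f * g))"
  proof -
    \<comment> \<open>\<open>E / p\<close> cancels the triple product, which turns the second term
      into the summand of index \<open>j\<close>.\<close>
    have "E / p * ((1 - v * J) * (1 - p * J) * (1 - w * y * J)) = 1"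
      using nz dd by (simp add: E_def)
    moreover have "(1 - y * p * J) / (p * J) = (1 - y * p * J) * (1 / p) * (1 / J)"
      by simp
    moreover have "E / p = E * (1 / p)" "(c * s\<^sup>2 - 1) / J = (c * s\<^sup>2 - 1) * (1 / J)"
        "(1 - y * J) / J = (1 - y * J) * (1 / J)"
      by simp_all
    ultimately show ?thesis
      unfolding R0 by algebra
  qed
  also have "\<dots> = (c * s\<^sup>2 - 1) * ((1 / p ^ k - y) * u s k
         - (if k = 0 then 0 else (1 / p ^ (k - 1) - y) * u s (k - 1)))"
  proof -
    have "(1 - y * p * J) / (p * J) = 1 / p ^ k - y" "(1 - y * J) / J = 1 / p ^ (k - 1) - y"
      using J nz by (simp_all add: Suc J_def field_simps)
    then show ?thesis
      unfolding uk[symmetric] uj[symmetric] by (simp add: Suc)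
  qed
  finally show ?thesis .
qed

section \<open>Summation over the index and the boundary term\<close>

lemma sum_backward_diff:
  fixes F :: "nat \<Rightarrow> real"
  shows "(\<Sum>k\<le>n. F k - (if k = 0 then 0 else F (k - 1))) = F n"
  by (induction n) auto

text \<open>This is the recurrence with the normalising factors eliminated: up to the factor
  \<open>- g\<close> of the final proof, the first bracket is a multiple of the difference of the
  functions of index \<open>m + 1\<close> and \<open>m\<close>, and the second, for
  \<open>m > 0\<close>, of those of index \<open>m - 1\<close> and \<open>m\<close>.\<close>

lemma qHahn_sum_recurrence:
  fixes p s v be w y :: real and N :: nat
  defines "c \<equiv> be * v"
  defines "S \<equiv> \<lambda>t. \<Sum>k\<le>N. qHahn_term p y w v c t k"
  assumes nz: "p \<noteq> 0" "s \<noteq> 0"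
    and d: "1 - c * s\<^sup>2 * p \<noteq> 0" "1 - c * s\<^sup>2 / p \<noteq> 0"
    and def: "\<And>k. k \<le> N \<Longrightarrow> qpoch v p k \<noteq> 0 \<and> qpoch (w * y) p k \<noteq> 0 \<and> qpoch p p k \<noteq> 0"
    and y: "qpoch y p (Suc N) = 0"
  shows
    "(y * w * s - 1) * (1 - c * s) / (1 - c * s\<^sup>2 * p)
         * ((1 - v * s) * S (s * p) + v * s * (1 - s * be * p) * S s)
     + (y * w - c * s) * (1 - s) / (1 - c * s\<^sup>2 / p)
         * (v * s / p * (1 - s * be) * S (s / p) + (1 - s * v / p) * S s)
     + y * (1 - w) * (1 - c * s\<^sup>2) * S s = 0" (is "?L = 0")
proof -
  let ?u = "qHahn_term p y w v c"
  let ?F = "\<lambda>k. (1 / p ^ k - y) * ?u s k"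
  have "?L = (\<Sum>k\<le>N. (y * w * s - 1) * (1 - c * s) / (1 - c * s\<^sup>2 * p)
         * ((1 - v * s) * ?u (s * p) k + v * s * (1 - s * be * p) * ?u s k)
     + (y * w - c * s) * (1 - s) / (1 - c * s\<^sup>2 / p)
         * (v * s / p * (1 - s * be) * ?u (s / p) k + (1 - s * v / p) * ?u s k)
     + y * (1 - w) * (1 - c * s\<^sup>2) * ?u s k)"
    unfolding S_def by (simp only: sum.distrib sum_distrib_left[symmetric])
  also have "\<dots> = (\<Sum>k\<le>N. (c * s\<^sup>2 - 1) * (?F k - (if k = 0 then 0 else ?F (k - 1))))"
    unfolding c_def
    by (intro sum.cong refl qHahn_term_telescope) (use nz d def in \<open>auto simp: c_def\<close>)
  also have "\<dots> = (c * s\<^sup>2 - 1) * ?F N"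
    by (simp only: sum_distrib_left[symmetric] sum_backward_diff[of ?F])
  also have "\<dots> = 0"
  proof -
    have "qpoch y p N = 0 \<or> y = 1 / p ^ N"
      using y nz by (auto simp: qpoch_Suc field_simps)
    then show ?thesis
      by (auto simp: qHahn_term_def)
  qed
  finally show ?thesis .
qed

section \<open>Normalising factors and extension of the sums to N\<close>

definition qHahn_prefactor :: "real \<Rightarrow> nat \<Rightarrow> real \<Rightarrow> nat \<Rightarrow> real" where
  "qHahn_prefactor b N p m = p powr (real m * (real N - real m - b))
     * (qpoch (p powr (- real N)) p m / qpoch (p powr (- real m - b)) p m)"

text \<open>The numerator symbol has a fixed base and gains a last factor \<open>1 - t\<close>. The
  base of the denominator symbol moves with \<open>m\<close>, so that symbol gains a first factor
  \<open>1 - 1 / z\<close>. The power of \<open>p\<close> contributes \<open>1 / (t * z)\<close>,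
  and the sign comes from \<open>1 - z = - z * (1 - 1 / z)\<close>.\<close>

lemma qHahn_prefactor_Suc:
  assumes p: "p > 0"
    and def: "qpoch (p powr (- real (Suc m) - b)) p (Suc m) \<noteq> 0"
  shows "p powr (real m - real N) * (1 - p powr (real m + 1 + b)) * qHahn_prefactor b N p (Suc m)
       = - (1 - p powr (real m - real N)) * qHahn_prefactor b N p m"
proof -
  define z where "z = p powr (real m + 1 + b)"
  define e where "e = p powr (real m * (real N - real m - b))"
  define t where "t = p powr (real m - real N)"
  have pos: "z > 0" "t > 0"
    using p by (simp_all add: z_def t_def)
  have zi: "p powr (- real (Suc m) - b) = 1 / z"
    using p by (simp add: z_def powr_minus_divide[symmetric] algebra_simps)
  have "p powr (- real (Suc m) - b) * p = p powr (- real m - b)"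
    using p powr_mult_base[of p "- real (Suc m) - b"] by (simp add: mult.commute)
  then have den: "qpoch (p powr (- real (Suc m) - b)) p (Suc m)
      = (1 - 1 / z) * qpoch (p powr (- real m - b)) p m"
    by (simp only: qpoch_Suc_left zi)
  have num: "qpoch (p powr (- real N)) p (Suc m) = qpoch (p powr (- real N)) p m * (1 - t)"
    using p by (simp add: qpoch_Suc t_def powr_realpow[symmetric] powr_add[symmetric])
  have ex: "p powr (real (Suc m) * (real N - real (Suc m) - b)) = e / (t * z)"
    using p by (simp add: e_def t_def z_def powr_add[symmetric] powr_diff[symmetric] algebra_simps)
  have "1 - 1 / z \<noteq> 0"
    using def den by auto
  then have "z \<noteq> 1" by auto
  then have "(1 - z) / (z * (1 - 1 / z)) = -1"
    using pos by (simp add: field_simps)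
  moreover have "t * (1 - z) * qHahn_prefactor b N p (Suc m)
      = (1 - z) / (z * (1 - 1 / z)) * (1 - t) * qHahn_prefactor b N p m"
    unfolding qHahn_prefactor_def den num ex e_def[symmetric] using pos by (simp add: mult_ac)
  ultimately show ?thesis
    by (simp add: t_def z_def)
qed

text \<open>The symbol with base \<open>p powr (- real m)\<close> vanishes for \<open>k > m\<close>.
  A range independent of \<open>m\<close> allows neighbouring indices to be combined term by
  term.\<close>

lemma qHahn_U_eq_sum_le_N:
  assumes p: "p > 0" and "m \<le> N"
  shows "qHahn_U m x al b N p = qHahn_prefactor b N p m
    * (\<Sum>k\<le>N. qHahn_term p (p powr (- x)) (p powr al) (p powr (- real N))
          (p powr b * p powr (- real N)) (p powr real m) k)"
proof -
  have e: "1 / p powr real m = p powr (- real m)"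
      "p powr al * p powr (- x) = p powr (al - x)"
      "p powr b * p powr (- real N) * p powr real m = p powr (b + real m - real N)"
    using p by (simp_all add: powr_minus_divide powr_add powr_diff)
  have "qpoch (p powr (- real m)) p (Suc m) = 0"
    using p by (simp add: qpoch_Suc powr_realpow[symmetric] powr_add[symmetric])
  then have z: "qpoch (p powr (- real m)) p k = 0" if "k > m" for k
    using that qpoch_eq_0_mono[of _ _ "Suc m" k] by auto
  show ?thesis
    unfolding qHahn_U_def qHahn_prefactor_def qHahn_term_def e
    by (rule arg_cong[where f = "(*) _"], rule sum.mono_neutral_left)
       (use \<open>m \<le> N\<close> z in auto)
qed

section \<open>Translation back to the original parameters\<close>

theorem proposition7p7:
  fixes q a b :: real and N m n :: nat
  assumes "q > 0" and "q \<noteq> 1" and "N \<ge> 1"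
    and "\<And>j i. j \<le> N \<Longrightarrow> i \<le> N \<Longrightarrow> qHahn_V_defined j (real i) a b N q"
    and "\<And>j. j \<le> N \<Longrightarrow> qnum q (real N - 2 * real j - b - 1) \<noteq> 0"
    and "\<And>j. j \<le> N \<Longrightarrow> qnum q (2 * real j + b - real N - 1) \<noteq> 0"
    and "m \<le> N" and "n \<le> N"
  shows
    "qnum q (real n - real N + real m + b - a + 2)
       * q powr (2 * real N - 4 * real m - 2 * b) * rec_A m a b N q
       * (qHahn_V (m + 1) (real n) a b N q - qHahn_V m (real n) a b N q)
     + (if m = 0 then 0
        else qnum q (real n - real m - a + 2) * rec_C m a b N q
             * (qHahn_V (m - 1) (real n) a b N q - qHahn_V m (real n) a b N q))
     = - (q ^ 2) * qnum q (a - b - 2) * qnum q (real N - 2 * real m - b)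
         * qHahn_V m (real n) a b N q"
proof -
  \<comment> \<open>\<open>qHahn_V\<close> is \<open>qHahn_U\<close> at base \<open>1 / q\<close>
    with \<open>x\<close> replaced by \<open>N - n\<close> and \<open>a\<close> by
    \<open>b - a + 2\<close>; this dictates \<open>p\<close>, \<open>y\<close> and \<open>w\<close>.
    \<open>D\<close> is \<open>1 - q\<close>.\<close>
  define p where "p = 1 / q"
  have p: "p > 0" and qp: "q = 1 / p"
    using assms by (auto simp: p_def)
  define s where "s = p powr real m"
  define v where "v = p powr (- real N)"
  define be where "be = p powr b"
  define c where "c = be * v"
  define w where "w = p powr (b - a + 2)"
  define y where "y = p powr (- (real N - real n))"
  define D where "D = 1 - 1 / p"
  define S where "S t = (\<Sum>k\<le>N. qHahn_term p y w v c t k)" for t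
  define g where "g = qHahn_prefactor b N p m"
  note vars = s_def v_def be_def c_def w_def y_def
  have pos: "s > 0" "v > 0" "be > 0" "c > 0" "w > 0" "y > 0"
    using p by (simp_all add: vars)
  have D: "D \<noteq> 0"
    using assms qp by (simp add: D_def)
  have qpow: "q powr x = p powr (- x)" for x
    using p by (simp add: qp powr_divide powr_minus_divide)
  have sq: "s\<^sup>2 = p powr (2 * real m)" "s ^ 4 = p powr (4 * real m)"
    using p by (simp_all add: s_def powr_power mult.commute)
  have sp: "p powr (real m + 1) = s * p"
    using p by (simp add: s_def powr_add)
  have "q powr (real n - real N + real m + b - a + 2) = 1 / (s * w * y)"
    using p by (simp add: qpow vars powr_add[symmetric] powr_minus_divide[symmetric] algebra_simps)
  then have Q1: "qnum q (real n - real N + real m + b - a + 2) = (1 - 1 / (s * w * y)) / D"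
    by (simp add: qnum_def D_def qp)
  have "q powr (real n - real m - a + 2) = c * s / (y * w)"
    using p by (simp add: qpow vars powr_add[symmetric] powr_diff[symmetric] algebra_simps)
  then have Q2: "qnum q (real n - real m - a + 2) = (1 - c * s / (y * w)) / D"
    by (simp add: qnum_def D_def qp)
  have Q3: "q powr (2 * real N - 4 * real m - 2 * b) = c\<^sup>2 * s ^ 4"
    using p by (simp add: qpow sq)
      (simp add: vars power2_eq_square powr_add[symmetric] algebra_simps)
  have "q powr (- real m - b - 1) = s * be * p" "q powr (real m + b - real N) = 1 / (c * s)"
     "q powr (real N - 2 * real m - b - 1) = c * s\<^sup>2 * p"
     "q powr (a + real m) = w / (be * p\<^sup>2 * s)"
    using p unfolding sq qpow
    by (simp_all add: vars powr_add powr_diff powr_minus_divide field_simps power2_eq_square)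
  then have QA: "rec_A m a b N q = w / (be * p\<^sup>2 * s) * (((1 - s * be * p) / D * ((1 - 1 / (c * s)) / D))
       / ((1 - c * s\<^sup>2 * p) / D))"
    by (simp add: rec_A_def qnum_def D_def qp)
  have "q powr real m = 1 / s" "q powr (real m - real N - 1) = p / (s * v)"
     "q powr (2 * real m + b - real N - 1) = p / (c * s\<^sup>2)"
     "q powr a = w / (be * p\<^sup>2)"
    using p unfolding sq qpow
    by (simp_all add: vars powr_add powr_diff powr_minus_divide field_simps power2_eq_square)
  then have QC: "rec_C m a b N q = w / (be * p\<^sup>2) * (((1 - 1 / s) / D * ((1 - p / (s * v)) / D))
       / ((1 - p / (c * s\<^sup>2)) / D))"
    by (simp add: rec_C_def qnum_def D_def qp)
  have "q powr (a - b - 2) = w" "q powr (real N - 2 * real m - b) = c * s\<^sup>2"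
    using p unfolding sq by (simp_all add: qpow vars powr_add[symmetric] algebra_simps)
  then have QR: "qnum q (a - b - 2) = (1 - w) / D" "qnum q (real N - 2 * real m - b) = (1 - c * s\<^sup>2) / D"
    by (simp_all add: qnum_def D_def qp)
  have "q powr (real N - 2 * real m - b - 1) = c * s\<^sup>2 * p"
       "q powr (2 * real m + b - real N - 1) = p / (c * s\<^sup>2)"
    using p unfolding sq qpow
    by (simp_all add: vars powr_add powr_diff powr_minus_divide field_simps)
  then have d: "1 - c * s\<^sup>2 * p \<noteq> 0" "1 - c * s\<^sup>2 / p \<noteq> 0"
    using assms(5,6)[OF \<open>m \<le> N\<close>] p pos by (auto simp: qnum_def)
  have def: "qpoch (p powr (- real j - b)) p j \<noteq> 0" if "j \<le> N" for j
    using assms(4)[OF that \<open>n \<le> N\<close>] by (simp add: qHahn_V_defined_def qHahn_U_defined_def p_def)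
  \<comment> \<open>The extended sums need nonzero denominators for all \<open>k\<close> up to
    \<open>N\<close>, which the definedness assumption supplies at \<open>j = N\<close>.\<close>
  have "w * y = p powr (b - a + 2 - (real N - real n))"
    using p by (simp add: vars powr_add[symmetric] algebra_simps)
  then have def': "qpoch v p k \<noteq> 0 \<and> qpoch (w * y) p k \<noteq> 0 \<and> qpoch p p k \<noteq> 0" if "k \<le> N" for k
    using assms(4)[OF order.refl \<open>n \<le> N\<close>] that
    by (simp add: qHahn_V_defined_def qHahn_U_defined_def p_def[symmetric] v_def)
  have "y * p ^ (N - n) = 1"
    using p \<open>n \<le> N\<close> by (simp add: y_def powr_realpow[symmetric] powr_add[symmetric] of_nat_diff)
  then have "qpoch y p (Suc (N - n)) = 0"
    by (simp add: qpoch_Suc)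
  then have y0: "qpoch y p (Suc N) = 0"
    by (rule qpoch_eq_0_mono) simp
  have V: "qHahn_V j (real n) a b N q = qHahn_prefactor b N p j * S (p powr real j)" if "j \<le> N" for j
    unfolding qHahn_V_def p_def[symmetric] S_def vars
    by (rule qHahn_U_eq_sum_le_N[OF p that])
  have V0: "qHahn_V m (real n) a b N q = g * S s"
    using V[OF \<open>m \<le> N\<close>] by (simp add: g_def s_def)
  have vs: "p powr (real m - real N) = v * s"
    using p by (simp add: vars powr_add[symmetric])
  have Vp: "v * s * (1 - s * be * p) * qHahn_V (m + 1) (real n) a b N q = - (1 - v * s) * g * S (s * p)"
  proof (cases "m < N")
    case True
    have "p powr (real m + 1 + b) = s * be * p"
      using p by (simp add: vars powr_add)
    then have "v * s * (1 - s * be * p) * qHahn_prefactor b N p (Suc m) = - (1 - v * s) * g"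
      using qHahn_prefactor_Suc[OF p def[of "Suc m"], of N] True by (simp add: vs g_def)
    moreover have "qHahn_V (m + 1) (real n) a b N q = qHahn_prefactor b N p (Suc m) * S (s * p)"
      using V[of "m + 1"] True sp by (simp add: add.commute)
    ultimately show ?thesis by simp
  next
    \<comment> \<open>At \<open>m = N\<close> both sides vanish: the left by the convention for
      index \<open>N + 1\<close>, the right because \<open>v * s = 1\<close>.\<close>
    case False
    then have "m = N" using \<open>m \<le> N\<close> by simp
    then show ?thesis
      using vs p qHahn_V_Suc_N[OF \<open>q > 0\<close>] by simp
  qed
  have Vm: "(1 - s * v / p) * qHahn_V (m - 1) (real n) a b N q = - (v * s / p * (1 - s * be) * g * S (s / p))"
    if "m \<noteq> 0"
  proof -
    obtain l where l: "m = Suc l" using \<open>m \<noteq> 0\<close> not0_implies_Suc by blast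
    have "p powr real l = s / p" "p powr (real l - real N) = v * s / p" "p powr (real l + 1 + b) = s * be"
      using p by (simp_all add: vars l powr_add powr_diff powr_minus_divide)
    moreover from this have "qHahn_V (m - 1) (real n) a b N q = qHahn_prefactor b N p l * S (s / p)"
      using V[of l] l \<open>m \<le> N\<close> by simp
    moreover have "v * s / p * (1 - s * be) * g = - (1 - v * s / p) * qHahn_prefactor b N p l"
      using qHahn_prefactor_Suc[OF p def[of "Suc l"], of N] calculation(2,3) l \<open>m \<le> N\<close>
      by (simp add: g_def)
    ultimately show ?thesis unfolding mult.commute[of s v] by algebra
  qed
  let ?V = "\<lambda>j. qHahn_V j (real n) a b N q"
  \<comment> \<open>\<open>?k * g\<close> is the common factor between the terms of the recurrence
    and those of \<open>qHahn_sum_recurrence\<close>; \<open>1\<close>, \<open>2\<close> and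
    \<open>3\<close> match them one by one.\<close>
  let ?k = "1 / (y * p\<^sup>2 * D\<^sup>2)"
  have 1: "qnum q (real n - real N + real m + b - a + 2)
       * q powr (2 * real N - 4 * real m - 2 * b) * rec_A m a b N q * (?V (m + 1) - ?V m)
     = ?k * g * ((y * w * s - 1) * (1 - c * s) / (1 - c * s\<^sup>2 * p)
         * ((1 - v * s) * S (s * p) + v * s * (1 - s * be * p) * S s))"
  proof -
    have "qnum q (real n - real N + real m + b - a + 2)
       * q powr (2 * real N - 4 * real m - 2 * b) * rec_A m a b N q
     = - ?k * ((y * w * s - 1) * (1 - c * s) / (1 - c * s\<^sup>2 * p)) * (v * s * (1 - s * be * p))"
      unfolding Q1 Q3 QA c_def using pos p D d
      by (simp add: c_def divide_simps) algebra
    then show ?thesis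
      using Vp unfolding V0 by algebra
  qed
  have 2: "(if m = 0 then 0 else qnum q (real n - real m - a + 2) * rec_C m a b N q * (?V (m - 1) - ?V m))
     = ?k * g * ((y * w - c * s) * (1 - s) / (1 - c * s\<^sup>2 / p)
         * (v * s / p * (1 - s * be) * S (s / p) + (1 - s * v / p) * S s))"
  proof (cases "m = 0")
    \<comment> \<open>Here \<open>s = 1\<close>, so the factor \<open>1 - s\<close> removes the term
      that the recurrence omits.\<close>
    case True
    then show ?thesis using p by (simp add: s_def)
  next
    case False
    have "p - c * s\<^sup>2 \<noteq> 0"
      using d p by (simp add: field_simps)
    moreover have "1 - p / (c * s\<^sup>2) = - (p - c * s\<^sup>2) / (c * s\<^sup>2)" "1 - c * s\<^sup>2 / p = (p - c * s\<^sup>2) / p"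
      using p pos by (simp_all add: field_simps)
    ultimately have "qnum q (real n - real m - a + 2) * rec_C m a b N q
      = - ?k * ((y * w - c * s) * (1 - s) / (1 - c * s\<^sup>2 / p)) * (1 - s * v / p)"
      unfolding Q2 QC using pos p D
      by (simp add: c_def divide_simps) algebra
    then show ?thesis
      using False Vm[OF False] unfolding V0 by (simp only: if_False) algebra
  qed
  have 3: "- (q ^ 2) * qnum q (a - b - 2) * qnum q (real N - 2 * real m - b) * ?V m
     = - ?k * g * (y * (1 - w) * (1 - c * s\<^sup>2) * S s)"
    unfolding QR V0 using pos p D by (simp add: qp divide_simps power2_eq_square)
  have "(y * w * s - 1) * (1 - c * s) / (1 - c * s\<^sup>2 * p)
         * ((1 - v * s) * S (s * p) + v * s * (1 - s * be * p) * S s)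
     + (y * w - c * s) * (1 - s) / (1 - c * s\<^sup>2 / p)
         * (v * s / p * (1 - s * be) * S (s / p) + (1 - s * v / p) * S s)
     + y * (1 - w) * (1 - c * s\<^sup>2) * S s = 0"
    unfolding S_def c_def
    by (rule qHahn_sum_recurrence) (use p pos d def' y0 in \<open>auto simp: c_def\<close>)
  then show ?thesis
    unfolding 1 2 3 by algebra
qed

end
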